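(* The problem of assortment optimization with customization under MMNL choice, $$\max_{S\subseteq N,\ |S|\le k}\ \sum_{j\in[m]}\alpha_j\max_{X\subseteq S}R_{\phi_j}(X),$$ is an instance of cardinality constrained submodular order maximization; that is, the function $F(S)=\sum_{j\in[m]}\alpha_j\max_{X\subseteq S}R_{\phi_j}(X)$ on $2^N$ is monotone, subadditive, and has a (strong) submodular order.
   Context: $N$ is a finite set of products with fixed prices $r_i\ge0$, $i\in N$. There are $m$ customer types; a random customer is of type $j\in[m]=\{1,\dots,m\}$ with probability $\alpha_j\ge0$. Type $j$ customers choose according to a multinomial logit (MNL) model $\phi_j$ with parameters $v_{j,i}\ge0$ ($i\in N$) and $v_{j,0}\ge0$ (outside option): from an offered assortment $S$, product $i\in S$ is chosen with probability $$\phi_j(i,S)=\frac{v_{j,i}}{v_{j,0}+\sum_{e\in S}v_{j,e}}$$ (taken to be $0$ if the denominator is $0$). The expected revenue is $R_{\phi_j}(S)=\sum_{i\in S}r_i\phi_j(i,S)$, with $R_{\phi_j}(\emptyset)=0$. The mixture of these models is the MMNL choice model. A set function $f$ is monotone if $f(A)\ge f(B)$ whenever $B\subseteq A$, and subadditive if $f(A)+f(B)\ge f(A\cup B)$ for all $A,B$. Write $f(X\mid S)=f(X\cup S)-f(S)$. A permutation $\pi$ of $N$ is a (strong) submodular order for $f$ if $f(C\mid A)\le f(C\mid B)$ for all $B\subseteq A\subseteq N$ and all $C\subseteq N$ lying entirely to the right of $A$ in $\pi$ (every element of $C$ comes after every element of $A$). *)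

theory Defs
  imports Complex_Main "HOL-Combinatorics.Multiset_Permutations"
begin

section \<open>Submodular order maximization\<close>

definition subadditive_on :: "'a set \<Rightarrow> ('a set \<Rightarrow> real) \<Rightarrow> bool" where
  "subadditive_on N f \<longleftrightarrow> (\<forall>A B. A \<subseteq> N \<longrightarrow> B \<subseteq> N \<longrightarrow> f (A \<union> B) \<le> f A + f B)"

definition marginal :: "('a set \<Rightarrow> real) \<Rightarrow> 'a set \<Rightarrow> 'a set \<Rightarrow> real" where
  "marginal f X S = f (X \<union> S) - f S"

text \<open>
  A permutation of \<open>N\<close> is a duplicate-free list that enumerates \<open>N\<close>. An element to the right of
  \<open>A\<close> is strictly later than every element of \<open>A\<close>; in particular \<open>C\<close> is disjoint from \<open>A\<close>.
\<close>

definition comes_after :: "'a list \<Rightarrow> 'a \<Rightarrow> 'a \<Rightarrow> bool" where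
  "comes_after \<pi> c a \<longleftrightarrow> (\<exists>i j. i < j \<and> j < length \<pi> \<and> \<pi> ! i = a \<and> \<pi> ! j = c)"

definition right_of :: "'a list \<Rightarrow> 'a set \<Rightarrow> 'a set \<Rightarrow> bool" where
  "right_of \<pi> C A \<longleftrightarrow> (\<forall>c\<in>C. \<forall>a\<in>A. comes_after \<pi> c a)"

definition strong_submodular_order :: "'a set \<Rightarrow> ('a set \<Rightarrow> real) \<Rightarrow> 'a list \<Rightarrow> bool" where
  "strong_submodular_order N f \<pi> \<longleftrightarrow>
     \<pi> \<in> permutations_of_set N \<and>
     (\<forall>A B C. B \<subseteq> A \<longrightarrow> A \<subseteq> N \<longrightarrow> C \<subseteq> N \<longrightarrow> right_of \<pi> C A \<longrightarrow>
        marginal f C A \<le> marginal f C B)"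

text \<open>A maximization problem over sets is a pair of its feasible family and its objective.\<close>

type_synonym 'a max_problem = "'a set set \<times> ('a set \<Rightarrow> real)"

definition card_constrained_submodular_order_max ::
    "'a set \<Rightarrow> nat \<Rightarrow> 'a max_problem \<Rightarrow> bool" where
  "card_constrained_submodular_order_max N k P \<longleftrightarrow>
     fst P = {S. S \<subseteq> N \<and> card S \<le> k} \<and>
     mono_on (Pow N) (snd P) \<and>
     subadditive_on N (snd P) \<and>
     (\<exists>\<pi>. strong_submodular_order N (snd P) \<pi>)"


section \<open>Assortment optimization with customization\<close>

text \<open>
  \<open>w\<close> is the parameter of the outside option. \<open>mnl_choice v w i S\<close> is meaningful for \<open>i \<in> S\<close> only.
  It is \<open>0\<close> when the denominator vanishes, by \<open>x / 0 = 0\<close>.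
\<close>

definition mnl_choice :: "('a \<Rightarrow> real) \<Rightarrow> real \<Rightarrow> 'a \<Rightarrow> 'a set \<Rightarrow> real" where
  "mnl_choice v w i S = v i / (w + (\<Sum>e\<in>S. v e))"

definition revenue :: "('a \<Rightarrow> real) \<Rightarrow> ('a \<Rightarrow> 'a set \<Rightarrow> real) \<Rightarrow> 'a set \<Rightarrow> real" where
  "revenue r \<phi> S = (\<Sum>i\<in>S. r i * \<phi> i S)"

text \<open>The maximum is over a finite nonempty set whenever \<open>S\<close> is finite.\<close>

definition customization_revenue ::
    "('a \<Rightarrow> real) \<Rightarrow> nat \<Rightarrow> (nat \<Rightarrow> real) \<Rightarrow> (nat \<Rightarrow> 'a \<Rightarrow> 'a set \<Rightarrow> real) \<Rightarrow> 'a set \<Rightarrow> real" where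
  "customization_revenue r m \<alpha> \<phi> S =
     (\<Sum>j\<in>{1..m}. \<alpha> j * Max ((\<lambda>X. revenue r (\<phi> j) X) ` Pow S))"

definition customization_problem ::
    "'a set \<Rightarrow> nat \<Rightarrow> ('a \<Rightarrow> real) \<Rightarrow> nat \<Rightarrow> (nat \<Rightarrow> real) \<Rightarrow> (nat \<Rightarrow> 'a \<Rightarrow> 'a set \<Rightarrow> real)
      \<Rightarrow> 'a max_problem" where
  "customization_problem N k r m \<alpha> \<phi> =
     ({S. S \<subseteq> N \<and> card S \<le> k}, customization_revenue r m \<alpha> \<phi>)"

end

theory Submission
  imports Defs
begin

text \<open>
  For one MNL customer with prices \<open>r\<close>, weights \<open>v\<close> and outside weight \<open>w\<close>, the optimal revenue
  \<open>G S\<close> from a subset of \<open>S\<close> is governed by a fixed-point inequality: for \<open>z \<ge> 0\<close>,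
  \<open>G S \<le> z\<close> holds iff \<open>(\<Sum>i\<in>S. v i * max 0 (r i - z)) \<le> w * z\<close>
  (\<open>best_revenue_le_iff\<close>). Clearing the denominator in \<open>revenue X \<le> z\<close> leaves
  \<open>(\<Sum>i\<in>X. v i * (r i - z)) \<le> w * z\<close>, and the worst \<open>X\<close> collects the products priced above \<open>z\<close>.

  The left-hand side of the inequality is additive over disjoint sets and antitone in \<open>z\<close>, so that
  inequalities for the parts combine into an upper bound on \<open>G\<close> of a union. Subadditivity is the
  test at \<open>z = G A + G B\<close>. For the submodular order, list the products by descending price. With \<open>B \<subseteq> A\<close>
  and \<open>C\<close> to the right of \<open>A\<close>, the test point is \<open>z = G A + (G (C \<union> B) - G B)\<close>. Either no product
  of \<open>C\<close> is priced above \<open>z\<close>, and then \<open>C\<close> contributes nothing at \<open>z\<close>; or some product is, and then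
  by the order every product of \<open>A\<close> is priced above \<open>z\<close>, all positive parts over \<open>A\<close> are plain
  linear functions of \<open>z\<close>, and the inequality for \<open>C \<union> A\<close> follows by adding those for \<open>A\<close> and
  \<open>C \<union> B\<close> and subtracting the one for \<open>B\<close>, which is tight (\<open>marginal_best_revenue_le\<close>).

  The order depends on the prices only, so it serves all customer types at once, and the three
  properties pass to the mixture because they are preserved by nonnegative combinations.
\<close>

section \<open>Optimal revenue from a single MNL customer\<close>

locale mnl_customer =
  fixes N :: "'a set" and r v :: "'a \<Rightarrow> real" and w :: real
  assumes finite_N: "finite N"
    and v_nonneg: "i \<in> N \<Longrightarrow> 0 \<le> v i"
    and w_nonneg: "0 \<le> w"
begin

abbreviation rev :: "'a set \<Rightarrow> real" where
  "rev \<equiv> revenue r (mnl_choice v w)"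

definition best_revenue :: "'a set \<Rightarrow> real" where
  "best_revenue S = Max (rev ` Pow S)"

definition excess :: "'a set \<Rightarrow> real \<Rightarrow> real" where
  "excess S z = (\<Sum>i\<in>S. v i * max 0 (r i - z))"

lemma finite_subset_N: "S \<subseteq> N \<Longrightarrow> finite S"
  using finite_N finite_subset by blast

lemma rev_eq_quotient: "rev X = (\<Sum>i\<in>X. v i * r i) / (w + sum v X)"
  by (simp add: revenue_def mnl_choice_def sum_divide_distrib mult.commute)

lemma sum_v_nonneg: "X \<subseteq> N \<Longrightarrow> 0 \<le> sum v X"
  by (meson subsetD sum_nonneg v_nonneg)

text \<open>
  A vanishing denominator forces \<open>w = 0\<close> and \<open>v = 0\<close> on \<open>X\<close>, so that the convention \<open>x / 0 = 0\<close>
  keeps the linearized form valid.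
\<close>

lemma zero_denominator:
  assumes "X \<subseteq> N" "w + sum v X = 0"
  shows "w = 0" "\<And>i. i \<in> X \<Longrightarrow> v i = 0"
proof -
  have "0 \<le> sum v X" using sum_v_nonneg assms(1) .
  with assms(2) w_nonneg show "w = 0" by linarith
  with assms(2) have "sum v X = 0" by simp
  then show "\<And>i. i \<in> X \<Longrightarrow> v i = 0"
    using assms(1) finite_subset_N[OF assms(1)] v_nonneg by (subst (asm) sum_nonneg_eq_0_iff) auto
qed

lemma sum_v_times_diff: "(\<Sum>i\<in>X. v i * (r i - z)) = (\<Sum>i\<in>X. v i * r i) - z * sum v X"
  by (simp add: right_diff_distrib sum_subtractf sum_distrib_left mult.commute)

lemma rev_le_iff:
  assumes "X \<subseteq> N" "0 \<le> z"
  shows "rev X \<le> z \<longleftrightarrow> (\<Sum>i\<in>X. v i * (r i - z)) \<le> w * z"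
proof (cases "w + sum v X = 0")
  case True
  then show ?thesis
    using zero_denominator[OF assms(1) True] assms(2)
    by (simp add: revenue_def mnl_choice_def)
next
  case False
  then have "0 < w + sum v X"
    using sum_v_nonneg[OF assms(1)] w_nonneg by linarith
  then show ?thesis
    unfolding sum_v_times_diff by (simp add: rev_eq_quotient divide_le_eq algebra_simps)
qed

lemma linear_part_eq_rev:
  assumes "X \<subseteq> N"
  shows "(\<Sum>i\<in>X. v i * (r i - rev X)) = w * rev X"
proof (cases "w + sum v X = 0")
  case True
  then show ?thesis
    using zero_denominator[OF assms True] by simp
next
  case False
  then have "rev X * (w + sum v X) = (\<Sum>i\<in>X. v i * r i)"
    by (simp add: rev_eq_quotient)
  then show ?thesis
    unfolding sum_v_times_diff by (simp add: algebra_simps)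
qed

lemma best_revenue_attained:
  assumes "S \<subseteq> N"
  obtains X where "X \<subseteq> S" "best_revenue S = rev X"
proof -
  have "best_revenue S \<in> rev ` Pow S"
    unfolding best_revenue_def using finite_subset_N[OF assms] by (intro Max_in) auto
  then show ?thesis using that by auto
qed

lemma best_revenue_le_iff_all:
  assumes "S \<subseteq> N"
  shows "best_revenue S \<le> z \<longleftrightarrow> (\<forall>X\<subseteq>S. rev X \<le> z)"
proof -
  have "finite (rev ` Pow S)" "rev ` Pow S \<noteq> {}"
    using finite_subset_N[OF assms] by auto
  from Max_le_iff[OF this] show ?thesis by (auto simp: best_revenue_def)
qed

lemma rev_le_best_revenue: "S \<subseteq> N \<Longrightarrow> X \<subseteq> S \<Longrightarrow> rev X \<le> best_revenue S"
  using best_revenue_le_iff_all by blast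

lemma best_revenue_nonneg: "S \<subseteq> N \<Longrightarrow> 0 \<le> best_revenue S"
  using rev_le_best_revenue[of S "{}"] by (simp add: revenue_def)

lemma best_revenue_mono:
  assumes "S \<subseteq> T" "T \<subseteq> N"
  shows "best_revenue S \<le> best_revenue T"
proof -
  have "S \<subseteq> N" using assms by simp
  moreover have "rev X \<le> best_revenue T" if "X \<subseteq> S" for X
    using rev_le_best_revenue[OF assms(2)] that assms(1) by simp
  ultimately show ?thesis using best_revenue_le_iff_all by simp
qed

text \<open>
  Among all \<open>X \<subseteq> S\<close> the linear sum is largest when \<open>X\<close> keeps exactly the terms with positive factor
  \<open>r i - z\<close>, and its value there is the excess.
\<close>

lemma best_revenue_le_iff:
  assumes "S \<subseteq> N" "0 \<le> z"
  shows "best_revenue S \<le> z \<longleftrightarrow> excess S z \<le> w * z"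
proof
  let ?X = "{i\<in>S. z < r i}"
  have "excess S z = (\<Sum>i\<in>?X. v i * (r i - z))"
    unfolding excess_def using finite_subset_N[OF assms(1)]
    by (intro sum.mono_neutral_cong_right) auto
  moreover assume "best_revenue S \<le> z"
  then have "rev ?X \<le> z" using best_revenue_le_iff_all[OF assms(1)] by simp
  moreover have "?X \<subseteq> N" using assms(1) by auto
  ultimately show "excess S z \<le> w * z" using rev_le_iff assms(2) by simp
next
  assume le: "excess S z \<le> w * z"
  have "rev X \<le> z" if "X \<subseteq> S" for X
  proof -
    have "(\<Sum>i\<in>X. v i * (r i - z)) \<le> excess X z"
      unfolding excess_def using that assms(1) v_nonneg
      by (intro sum_mono mult_left_mono) auto
    also have "\<dots> \<le> excess S z"
      unfolding excess_def using that assms(1) v_nonneg finite_subset_N[OF assms(1)]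
      by (intro sum_mono2) auto
    finally show ?thesis
      using le rev_le_iff[of X z] that assms by simp
  qed
  then show "best_revenue S \<le> z" using best_revenue_le_iff_all[OF assms(1)] by simp
qed

lemma excess_best_revenue_le:
  "S \<subseteq> N \<Longrightarrow> excess S (best_revenue S) \<le> w * best_revenue S"
  using best_revenue_le_iff best_revenue_nonneg by blast

lemma excess_antimono:
  assumes "S \<subseteq> N" "y \<le> z"
  shows "excess S z \<le> excess S y"
  unfolding excess_def using assms v_nonneg by (intro sum_mono mult_left_mono) auto

lemma excess_nonneg: "S \<subseteq> N \<Longrightarrow> 0 \<le> excess S z"
  unfolding excess_def using v_nonneg by (intro sum_nonneg) auto

lemma excess_Un_Int:
  assumes "S \<subseteq> N" "T \<subseteq> N"
  shows "excess (S \<union> T) z + excess (S \<inter> T) z = excess S z + excess T z"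
  unfolding excess_def by (intro sum.union_inter finite_subset_N assms)

lemma best_revenue_subadditive:
  assumes "A \<subseteq> N" "B \<subseteq> N"
  shows "best_revenue (A \<union> B) \<le> best_revenue A + best_revenue B"
proof -
  define a b where "a = best_revenue A" and "b = best_revenue B"
  have ab: "0 \<le> a" "0 \<le> b"
    using best_revenue_nonneg assms by (auto simp: a_def b_def)
  have "excess (A \<union> B) (a + b) \<le> excess A (a + b) + excess B (a + b)"
    using excess_Un_Int[OF assms, of "a + b"] excess_nonneg[of "A \<inter> B" "a + b"] assms
    by (simp add: le_infI1)
  also have "\<dots> \<le> excess A a + excess B b"
    using ab assms by (intro add_mono excess_antimono) auto
  also have "\<dots> \<le> w * (a + b)"
    using excess_best_revenue_le assms by (auto simp: a_def b_def distrib_left intro: add_mono)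
  finally show ?thesis
    using best_revenue_le_iff[of "A \<union> B" "a + b"] ab assms by (simp add: a_def b_def)
qed

text \<open>
  Tightness of the fixed-point inequality from below: an optimal \<open>X \<subseteq> B\<close> satisfies it with equality,
  and adding the remaining products of \<open>B\<close>, priced at least \<open>best_revenue B\<close>, only increases the sum.
\<close>

lemma linear_part_best_revenue_ge:
  assumes "B \<subseteq> N" and "\<And>i. i \<in> B \<Longrightarrow> best_revenue B \<le> r i"
  shows "w * best_revenue B \<le> (\<Sum>i\<in>B. v i * (r i - best_revenue B))"
proof -
  obtain X where X: "X \<subseteq> B" "best_revenue B = rev X"
    using best_revenue_attained assms(1) by blast
  have "w * best_revenue B = (\<Sum>i\<in>X. v i * (r i - best_revenue B))"
    using linear_part_eq_rev[of X] X assms(1) by simp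
  also have "\<dots> \<le> (\<Sum>i\<in>B. v i * (r i - best_revenue B))"
    using X(1) assms v_nonneg finite_subset_N[OF assms(1)] by (intro sum_mono2) auto
  finally show ?thesis .
qed

text \<open>
  Reaching \<open>C \<union> B\<close> from \<open>B\<close> raises the optimal revenue by \<open>c - b\<close> in the notation of the proof. The
  same rise above \<open>a = best_revenue A\<close> costs the products of \<open>A\<close> an excess of \<open>(c - b) * sum v A\<close>, at
  least the \<open>(c - b) * sum v B\<close> lost by \<open>B\<close>, and leaves \<open>C\<close> a smaller excess because
  \<open>z = a + (c - b) \<ge> c\<close>. Hence \<open>z\<close> already bounds \<open>best_revenue (C \<union> A)\<close>. This accounting
  needs the excess of \<open>A\<close> and \<open>B\<close> to be affine in the price level up to \<open>z\<close>; the price comparison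
  between \<open>C\<close> and \<open>A\<close> ensures that as soon as some product of \<open>C\<close> is priced above \<open>z\<close>.
\<close>

lemma marginal_best_revenue_le:
  assumes "B \<subseteq> A" "A \<subseteq> N" "C \<subseteq> N" "C \<inter> A = {}"
    and cheaper: "\<And>c a. c \<in> C \<Longrightarrow> a \<in> A \<Longrightarrow> r c \<le> r a"
  shows "marginal best_revenue C A \<le> marginal best_revenue C B"
proof -
  define a b c where "a = best_revenue A" and "b = best_revenue B"
    and "c = best_revenue (C \<union> B)"
  define z where "z = a + (c - b)"
  have BN: "B \<subseteq> N" and CBN: "C \<union> B \<subseteq> N" and CAN: "C \<union> A \<subseteq> N" using assms by auto
  have "0 \<le> b" "b \<le> a" "b \<le> c"
    using best_revenue_nonneg[OF BN] best_revenue_mono[OF assms(1,2)]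
      best_revenue_mono[of B, OF _ CBN] by (auto simp: a_def b_def c_def)
  then have z: "0 \<le> z" "a \<le> z" "c \<le> z" "b \<le> z" by (auto simp: z_def)
  have split_A: "excess (C \<union> A) z = excess C z + excess A z"
    using excess_Un_Int[OF assms(3,2), of z] assms(4) by (simp add: excess_def)
  have "excess (C \<union> A) z \<le> w * z"
  proof (cases "\<exists>i\<in>C. z < r i")
    case False
    then have "excess C z = 0"
      unfolding excess_def by (intro sum.neutral) (auto simp: max_def)
    moreover have "excess A z \<le> w * z"
      using best_revenue_le_iff[OF assms(2) z(1)] z(2) by (simp add: a_def)
    ultimately show ?thesis by (simp add: split_A)
  next
    case True
    then have above: "z < r i" if "i \<in> A" for i
      using cheaper that by fastforce
    have linear: "excess S y = (\<Sum>i\<in>S. v i * (r i - y))" if "S \<subseteq> A" "y \<le> z" for S y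
      unfolding excess_def
    proof (rule sum.cong)
      fix i assume "i \<in> S"
      then have "y < r i" using above that by force
      then show "v i * max 0 (r i - y) = v i * (r i - y)" by simp
    qed simp
    have affine: "excess S x - excess S y = (y - x) * sum v S"
      if "S \<subseteq> A" "x \<le> z" "y \<le> z" for S x y
      unfolding linear[OF that(1,2)] linear[OF that(1,3)] sum_v_times_diff
      by (simp add: algebra_simps)
    have A: "excess A z \<le> w * a - (c - b) * sum v A"
      using affine[of A a z] excess_best_revenue_le[OF assms(2)] z
      by (simp add: z_def a_def)
    have "w * b \<le> (\<Sum>i\<in>B. v i * (r i - b))"
      unfolding b_def
    proof (rule linear_part_best_revenue_ge[OF BN])
      fix i assume "i \<in> B"
      then show "best_revenue B \<le> r i" using above[of i] assms(1) z(4) by (force simp: b_def)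
    qed
    then have B: "w * b \<le> excess B c + (c - b) * sum v B"
      using affine[of B b c] linear[of B b] assms(1) z by simp
    have "excess (C \<union> B) c = excess C c + excess B c"
    proof -
      have "C \<inter> B = {}" using assms(1,4) by auto
      then show ?thesis
        using excess_Un_Int[OF assms(3) BN, of c] by (simp add: excess_def)
    qed
    moreover have "excess (C \<union> B) c \<le> w * c"
      using excess_best_revenue_le[OF CBN] by (simp add: c_def)
    ultimately have C: "excess C z \<le> w * c - excess B c"
      using excess_antimono[OF assms(3) z(3)] by linarith
    have "(c - b) * sum v B \<le> (c - b) * sum v A"
      using \<open>b \<le> c\<close> assms(1,2) v_nonneg finite_subset_N[OF assms(2)]
      by (intro mult_left_mono sum_mono2) auto
    then have "excess C z + excess A z \<le> w * c + w * a - w * b"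
      using A B C by linarith
    then show ?thesis unfolding split_A by (simp add: z_def algebra_simps)
  qed
  then have "best_revenue (C \<union> A) \<le> z"
    using best_revenue_le_iff[OF CAN z(1)] by simp
  then show ?thesis
    by (simp add: marginal_def z_def a_def b_def c_def)
qed

end


section \<open>Ordering the products by descending price\<close>

lemma descending_permutation_exists:
  fixes r :: "'a \<Rightarrow> real"
  assumes "finite N"
  obtains \<pi> where "\<pi> \<in> permutations_of_set N" "\<And>c a. comes_after \<pi> c a \<Longrightarrow> r c \<le> r a"
proof -
  obtain xs where xs: "set xs = N" "distinct xs"
    using finite_distinct_list[OF assms] by blast
  let ?\<pi> = "sort_key (\<lambda>x. - r x) xs"
  have "?\<pi> \<in> permutations_of_set N"
    using xs by (simp add: permutations_of_set_def)
  moreover have "r c \<le> r a" if after: "comes_after ?\<pi> c a" for c a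
  proof -
    from after obtain i j where ij: "i < j" "j < length ?\<pi>" "?\<pi> ! i = a" "?\<pi> ! j = c"
      unfolding comes_after_def by blast
    have "sorted (map (\<lambda>x. - r x) ?\<pi>)" by simp
    then have "map (\<lambda>x. - r x) ?\<pi> ! i \<le> map (\<lambda>x. - r x) ?\<pi> ! j"
      by (rule sorted_nth_mono) (use ij in auto)
    then show ?thesis using ij by simp
  qed
  ultimately show ?thesis using that by blast
qed

lemma right_of_disjoint:
  assumes "distinct \<pi>" "right_of \<pi> C A"
  shows "C \<inter> A = {}"
proof -
  have "\<not> comes_after \<pi> x x" for x
    using assms(1) by (auto simp: comes_after_def distinct_conv_nth)
  then show ?thesis using assms(2) unfolding right_of_def by blast
qed


section \<open>Mixtures of MNL customers\<close>

lemma marginal_sum: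
  "marginal (\<lambda>S. \<Sum>j\<in>J. \<alpha> j * f j S) C A = (\<Sum>j\<in>J. \<alpha> j * marginal (f j) C A)"
  by (simp add: marginal_def right_diff_distrib sum_subtractf)

theorem theorem6:
  fixes N :: "'a set"
    and k m :: nat
    and r :: "'a \<Rightarrow> real"
    and \<alpha> :: "nat \<Rightarrow> real"
    and v :: "nat \<Rightarrow> 'a \<Rightarrow> real"
    and v0 :: "nat \<Rightarrow> real"
  assumes "finite N"
    and "\<And>i. i \<in> N \<Longrightarrow> 0 \<le> r i"
    and "\<And>j. j \<in> {1..m} \<Longrightarrow> 0 \<le> \<alpha> j"
    and "(\<Sum>j\<in>{1..m}. \<alpha> j) = 1"
    and "\<And>j i. j \<in> {1..m} \<Longrightarrow> i \<in> N \<Longrightarrow> 0 \<le> v j i"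
    and "\<And>j. j \<in> {1..m} \<Longrightarrow> 0 \<le> v0 j"
  shows "card_constrained_submodular_order_max N k
           (customization_problem N k r m \<alpha> (\<lambda>j. mnl_choice (v j) (v0 j)))"
proof -
  define G where "G j = mnl_customer.best_revenue r (v j) (v0 j)" for j
  define F where "F S = (\<Sum>j\<in>{1..m}. \<alpha> j * G j S)" for S
  have customer: "mnl_customer N (v j) (v0 j)" if "j \<in> {1..m}" for j
    using assms(1,5,6) that by unfold_locales auto
  have F: "customization_revenue r m \<alpha> (\<lambda>j. mnl_choice (v j) (v0 j)) = F"
    unfolding customization_revenue_def F_def G_def
    using mnl_customer.best_revenue_def[OF customer] by (intro ext sum.cong) auto
  have mono: "mono_on (Pow N) F"
    unfolding F_def G_def using assms(3) mnl_customer.best_revenue_mono[OF customer]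
    by (intro mono_onI sum_mono mult_left_mono) auto
  have subadditive: "subadditive_on N F"
    unfolding subadditive_on_def
  proof (intro allI impI)
    fix A B assume AB: "A \<subseteq> N" "B \<subseteq> N"
    have "F (A \<union> B) \<le> (\<Sum>j\<in>{1..m}. \<alpha> j * (G j A + G j B))"
      unfolding F_def G_def
      using assms(3) mnl_customer.best_revenue_subadditive[OF customer AB]
      by (intro sum_mono mult_left_mono) auto
    then show "F (A \<union> B) \<le> F A + F B"
      by (simp add: F_def distrib_left sum.distrib)
  qed
  obtain \<pi> where \<pi>: "\<pi> \<in> permutations_of_set N"
    and descending: "\<And>c a. comes_after \<pi> c a \<Longrightarrow> r c \<le> r a"
    using descending_permutation_exists[OF assms(1)] by blast
  have "marginal F C A \<le> marginal F C B"
    if "B \<subseteq> A" "A \<subseteq> N" "C \<subseteq> N" "right_of \<pi> C A" for A B C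
  proof -
    have "C \<inter> A = {}"
      using right_of_disjoint that(4) permutations_of_setD(2)[OF \<pi>] by blast
    moreover have "r c \<le> r a" if "c \<in> C" "a \<in> A" for c a
      using descending that \<open>right_of \<pi> C A\<close> unfolding right_of_def by blast
    ultimately have "marginal (G j) C A \<le> marginal (G j) C B" if "j \<in> {1..m}" for j
      unfolding G_def
      using mnl_customer.marginal_best_revenue_le[OF customer[OF that]]
        \<open>B \<subseteq> A\<close> \<open>A \<subseteq> N\<close> \<open>C \<subseteq> N\<close> by blast
    then show ?thesis
      unfolding F_def marginal_sum using assms(3) by (intro sum_mono mult_left_mono) auto
  qed
  with \<pi> have "strong_submodular_order N F \<pi>"
    unfolding strong_submodular_order_def by blast
  with mono subadditive show ?thesis
    unfolding card_constrained_submodular_order_max_def customization_problem_def F by auto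
qed

end
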